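(* The space $\tilde{\mathbb{I}}$ with the order topology induced by the linear order $<_{\mathrm{XY}}$ is not metrizable.
   Context: $\tilde{\mathbb{I}}=\{\langle\mu,\nu\rangle\in[0,1]^2 \mid \mu+\nu\le 1\}$ is the set of intuitionistic fuzzy values. For $\alpha=\langle\mu_\alpha,\nu_\alpha\rangle\in\tilde{\mathbb{I}}$ put $s(\alpha)=\mu_\alpha-\nu_\alpha$ and $h(\alpha)=\mu_\alpha+\nu_\alpha$. Define $\alpha<_{\mathrm{XY}}\beta$ iff $s(\alpha)<s(\beta)$, or $s(\alpha)=s(\beta)$ and $h(\alpha)<h(\beta)$. The order topology on a linearly ordered set $X$ has as a basis all intervals $(a,b)$, $(\leftarrow,b)=\{x: x<b\}$ and $(a,\rightarrow)=\{x: a<x\}$. *)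

theory Defs
  imports "HOL-Analysis.Analysis"
begin

text \<open>An intuitionistic fuzzy value is encoded as the pair of its membership degree \<open>\<mu> = fst \<alpha>\<close>
  and its non-membership degree \<open>\<nu> = snd \<alpha>\<close>.\<close>

definition IFV :: "(real \<times> real) set" where
  "IFV = {(\<mu>, \<nu>). \<mu> \<in> {0..1} \<and> \<nu> \<in> {0..1} \<and> \<mu> + \<nu> \<le> 1}"

definition score :: "real \<times> real \<Rightarrow> real" where
  "score \<alpha> = fst \<alpha> - snd \<alpha>"

definition accuracy :: "real \<times> real \<Rightarrow> real" where
  "accuracy \<alpha> = fst \<alpha> + snd \<alpha>"

definition less_XY :: "real \<times> real \<Rightarrow> real \<times> real \<Rightarrow> bool" (infix "<\<^sub>X\<^sub>Y" 50) where
  "\<alpha> <\<^sub>X\<^sub>Y \<beta> \<longleftrightarrow>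
     score \<alpha> < score \<beta> \<or> (score \<alpha> = score \<beta> \<and> accuracy \<alpha> < accuracy \<beta>)"

definition order_base :: "'a set \<Rightarrow> ('a \<Rightarrow> 'a \<Rightarrow> bool) \<Rightarrow> 'a set set" where
  "order_base X lt =
     {{x \<in> X. lt a x \<and> lt x b} | a b. a \<in> X \<and> b \<in> X} \<union>
     {{x \<in> X. lt x b} | b. b \<in> X} \<union>
     {{x \<in> X. lt a x} | a. a \<in> X}"

text \<open>The relation \<open>lt\<close> is meant to be a strict linear order on \<open>X\<close>, and \<open>X\<close> to have at least two
  points. Then the intervals cover \<open>X\<close> and form a base, so that \<open>topology_generated_by\<close>, which takes
  a subbase, yields exactly their unions; \<open>openin_order_topology_IFV\<close> confirms this for \<open>IFV\<close>.\<close>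

definition order_topology_on :: "'a set \<Rightarrow> ('a \<Rightarrow> 'a \<Rightarrow> bool) \<Rightarrow> 'a topology" where
  "order_topology_on X lt = topology_generated_by (order_base X lt)"

lemma less_XY_irrefl: "\<not> \<alpha> <\<^sub>X\<^sub>Y \<alpha>"
  by (simp add: less_XY_def)

lemma less_XY_trans: "\<alpha> <\<^sub>X\<^sub>Y \<beta> \<Longrightarrow> \<beta> <\<^sub>X\<^sub>Y \<gamma> \<Longrightarrow> \<alpha> <\<^sub>X\<^sub>Y \<gamma>"
  by (auto simp: less_XY_def)

lemma less_XY_linear: "\<alpha> <\<^sub>X\<^sub>Y \<beta> \<or> \<alpha> = \<beta> \<or> \<beta> <\<^sub>X\<^sub>Y \<alpha>"
  by (cases \<alpha>; cases \<beta>) (auto simp: less_XY_def score_def accuracy_def)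

lemma topspace_order_topology_IFV: "topspace (order_topology_on IFV (<\<^sub>X\<^sub>Y)) = IFV"
proof -
  have "(0, 1) \<in> IFV" "(1, 0) \<in> IFV" "(0, 1) <\<^sub>X\<^sub>Y (1, 0)"
    by (auto simp: IFV_def less_XY_def score_def)
  then have "x \<in> \<Union> (order_base IFV (<\<^sub>X\<^sub>Y))" if "x \<in> IFV" for x
    using that less_XY_linear[of x "(0, 1)"] less_XY_trans[of x "(0, 1)" "(1, 0)"]
    unfolding order_base_def by blast
  moreover have "\<Union> (order_base IFV (<\<^sub>X\<^sub>Y)) \<subseteq> IFV"
    unfolding order_base_def by blast
  ultimately show ?thesis
    unfolding order_topology_on_def topology_generated_by_topspace by blast
qed

lemma order_base_IFV_Int:
  assumes "U \<in> order_base IFV (<\<^sub>X\<^sub>Y)" "V \<in> order_base IFV (<\<^sub>X\<^sub>Y)"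
  shows "U \<inter> V \<in> order_base IFV (<\<^sub>X\<^sub>Y)"
proof -
  define L where "L = insert IFV {{x \<in> IFV. a <\<^sub>X\<^sub>Y x} | a. a \<in> IFV}"
  define R where "R = insert IFV {{x \<in> IFV. x <\<^sub>X\<^sub>Y b} | b. b \<in> IFV}"
  have LI: "A \<inter> A' \<in> L" if "A \<in> L" "A' \<in> L" for A A'
  proof -
    have nested: "{x \<in> IFV. a <\<^sub>X\<^sub>Y x} \<subseteq> {x \<in> IFV. a' <\<^sub>X\<^sub>Y x} \<or> {x \<in> IFV. a' <\<^sub>X\<^sub>Y x} \<subseteq> {x \<in> IFV. a <\<^sub>X\<^sub>Y x}" for a a'
      using less_XY_linear[of a a'] less_XY_trans[of a a'] less_XY_trans[of a' a] by auto
    have shape: "C = IFV \<or> (\<exists>a. C = {x \<in> IFV. a <\<^sub>X\<^sub>Y x})" if "C \<in> L" for C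
      using that unfolding L_def by blast
    have "A \<subseteq> A' \<or> A' \<subseteq> A"
      using shape[OF that(1)] shape[OF that(2)]
      by (elim disjE exE; hypsubst) (rule nested | blast)+
    then show ?thesis using that by (metis inf.absorb1 inf.absorb2)
  qed
  have RI: "A \<inter> A' \<in> R" if "A \<in> R" "A' \<in> R" for A A'
  proof -
    have nested: "{x \<in> IFV. x <\<^sub>X\<^sub>Y a} \<subseteq> {x \<in> IFV. x <\<^sub>X\<^sub>Y a'} \<or> {x \<in> IFV. x <\<^sub>X\<^sub>Y a'} \<subseteq> {x \<in> IFV. x <\<^sub>X\<^sub>Y a}" for a a'
      using less_XY_linear[of a a'] less_XY_trans[of _ a a'] less_XY_trans[of _ a' a] by auto
    have shape: "C = IFV \<or> (\<exists>a. C = {x \<in> IFV. x <\<^sub>X\<^sub>Y a})" if "C \<in> R" for C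
      using that unfolding R_def by blast
    have "A \<subseteq> A' \<or> A' \<subseteq> A"
      using shape[OF that(1)] shape[OF that(2)]
      by (elim disjE exE; hypsubst) (rule nested | blast)+
    then show ?thesis using that by (metis inf.absorb1 inf.absorb2)
  qed
  have base_imp: "\<exists>A\<in>L. \<exists>B\<in>R. W = A \<inter> B \<and> (A \<noteq> IFV \<or> B \<noteq> IFV)"
    if W: "W \<in> order_base IFV (<\<^sub>X\<^sub>Y)" for W
  proof -
    have neL: "{x \<in> IFV. a <\<^sub>X\<^sub>Y x} \<noteq> IFV" "{x \<in> IFV. x <\<^sub>X\<^sub>Y a} \<noteq> IFV" if "a \<in> IFV" for a
      using that less_XY_irrefl by blast+
    consider a b where "a \<in> IFV" "b \<in> IFV" "W = {x \<in> IFV. a <\<^sub>X\<^sub>Y x} \<inter> {x \<in> IFV. x <\<^sub>X\<^sub>Y b}"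
      | b where "b \<in> IFV" "W = IFV \<inter> {x \<in> IFV. x <\<^sub>X\<^sub>Y b}"
      | a where "a \<in> IFV" "W = {x \<in> IFV. a <\<^sub>X\<^sub>Y x} \<inter> IFV"
      using W unfolding order_base_def by blast
    then show ?thesis
    proof cases
      case 1 then show ?thesis using neL(1)[of a] unfolding L_def R_def by blast
    next
      case 2 then show ?thesis using neL(2)[of b] unfolding L_def R_def by blast
    next
      case 3 then show ?thesis using neL(1)[of a] unfolding L_def R_def by blast
    qed
  qed
  have base_if: "A \<inter> B \<in> order_base IFV (<\<^sub>X\<^sub>Y)"
    if "A \<in> L" "B \<in> R" "A \<noteq> IFV \<or> B \<noteq> IFV" for A B
  proof -
    have LR: "{x \<in> IFV. a <\<^sub>X\<^sub>Y x} \<inter> {x \<in> IFV. x <\<^sub>X\<^sub>Y b} = {x \<in> IFV. a <\<^sub>X\<^sub>Y x \<and> x <\<^sub>X\<^sub>Y b}"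
      "{x \<in> IFV. a <\<^sub>X\<^sub>Y x} \<inter> IFV = {x \<in> IFV. a <\<^sub>X\<^sub>Y x}"
      "IFV \<inter> {x \<in> IFV. x <\<^sub>X\<^sub>Y b} = {x \<in> IFV. x <\<^sub>X\<^sub>Y b}" for a b
      by auto
    show ?thesis
      using that unfolding L_def R_def order_base_def by (auto simp: LR)
  qed
  obtain A B where 1: "A \<in> L" "B \<in> R" "U = A \<inter> B" "A \<noteq> IFV \<or> B \<noteq> IFV"
    using base_imp[OF assms(1)] by blast
  obtain A' B' where 2: "A' \<in> L" "B' \<in> R" "V = A' \<inter> B'"
    using base_imp[OF assms(2)] by blast
  have "A' \<subseteq> IFV" "B' \<subseteq> IFV" "A \<subseteq> IFV" "B \<subseteq> IFV"
    using 1 2 unfolding L_def R_def by auto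
  then have "A \<inter> A' \<noteq> IFV \<or> B \<inter> B' \<noteq> IFV" using 1(4) by blast
  then have "(A \<inter> A') \<inter> (B \<inter> B') \<in> order_base IFV (<\<^sub>X\<^sub>Y)"
    using base_if[OF LI[OF 1(1) 2(1)] RI[OF 1(2) 2(2)]] by blast
  then show ?thesis
    using 1(3) 2(3) by (simp add: Int_ac)
qed

lemma openin_order_topology_IFV:
  "openin (order_topology_on IFV (<\<^sub>X\<^sub>Y)) =
     arbitrary union_of (\<lambda>U. U \<in> order_base IFV (<\<^sub>X\<^sub>Y))"
proof (rule ext, rule iffI)
  fix U assume "openin (order_topology_on IFV (<\<^sub>X\<^sub>Y)) U"
  then have "generate_topology_on (order_base IFV (<\<^sub>X\<^sub>Y)) U"
    by (simp add: order_topology_on_def openin_topology_generated_by_iff)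
  then show "(arbitrary union_of (\<lambda>U. U \<in> order_base IFV (<\<^sub>X\<^sub>Y))) U"
  proof induction
    case (Int a b)
    have "\<forall>S T. S \<in> order_base IFV (<\<^sub>X\<^sub>Y) \<and> T \<in> order_base IFV (<\<^sub>X\<^sub>Y) \<longrightarrow>
        (arbitrary union_of (\<lambda>U. U \<in> order_base IFV (<\<^sub>X\<^sub>Y))) (S \<inter> T)"
      by (simp add: arbitrary_union_of_inc order_base_IFV_Int)
    then show ?case
      using Int arbitrary_union_of_Int_eq[of "\<lambda>U. U \<in> order_base IFV (<\<^sub>X\<^sub>Y)"] by blast
  qed (auto intro: arbitrary_union_of_Union arbitrary_union_of_inc)
next
  fix U assume "(arbitrary union_of (\<lambda>U. U \<in> order_base IFV (<\<^sub>X\<^sub>Y))) U"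
  then show "openin (order_topology_on IFV (<\<^sub>X\<^sub>Y)) U"
    unfolding order_topology_on_def union_of_def
    by (auto intro!: openin_Union intro: topology_generated_by_Basis)
qed

end

theory Submission
  imports Defs
begin

text \<open>Every neighbourhood of the top of a fibre of the score map contains all nearby fibres of larger
  score, and every neighbourhood of the bottom contains all nearby fibres of smaller score. So in
  a compatible metric the distance between the two ends of the fibre over \<open>t\<close> tends to \<open>0\<close> as \<open>t\<close>
  tends to any \<open>l\<close>, \<open>t \<noteq> l\<close>. By compactness only finitely many fibres have ends more than
  \<open>\<epsilon>\<close> apart; as the ends of each fibre are distinct, there would be only countably many fibres.\<close>

text \<open>The fibre of the score over \<open>t\<close> is the set of values with accuracy in \<open>[\<bar>t\<bar>, 1]\<close>; only
  \<open>t \<in> [0, 1]\<close> is used, where \<open>\<bar>t\<bar> = t\<close>.\<close>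

definition fibre_bot :: "real \<Rightarrow> real \<times> real" where
  "fibre_bot t = (t, 0)"

definition fibre_top :: "real \<Rightarrow> real \<times> real" where
  "fibre_top t = ((1 + t) / 2, (1 - t) / 2)"

lemma fibre_bot_in_IFV: "t \<in> {0..1} \<Longrightarrow> fibre_bot t \<in> IFV"
  and fibre_top_in_IFV: "t \<in> {0..1} \<Longrightarrow> fibre_top t \<in> IFV"
  by (auto simp: fibre_bot_def fibre_top_def IFV_def field_simps)

lemma score_fibre_bot [simp]: "score (fibre_bot t) = t"
  and score_fibre_top [simp]: "score (fibre_top t) = t"
  by (auto simp: fibre_bot_def fibre_top_def score_def field_simps)

lemma fibre_bot_neq_fibre_top: "t < 1 \<Longrightarrow> fibre_bot t \<noteq> fibre_top t"
  by (simp add: fibre_bot_def fibre_top_def)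

text \<open>The top of a fibre has accuracy 1, the largest possible on \<open>IFV\<close>, so the
  tie-break on accuracy can never place \<open>b\<close> above it.\<close>

lemma fibre_top_less_XY_iff:
  assumes "b \<in> IFV"
  shows "fibre_top t <\<^sub>X\<^sub>Y b \<longleftrightarrow> t < score b"
proof -
  have "accuracy (fibre_top t) = 1" "accuracy b \<le> 1"
    using assms by (auto simp: fibre_top_def accuracy_def IFV_def field_simps)
  then show ?thesis by (auto simp: less_XY_def)
qed

text \<open>On \<open>IFV\<close> accuracy is at least the score, and \<open>fibre_bot t\<close>
  attains equality, so the tie-break can never place \<open>a\<close> below it.\<close>

lemma less_XY_fibre_bot_iff:
  assumes "a \<in> IFV"
  shows "a <\<^sub>X\<^sub>Y fibre_bot t \<longleftrightarrow> score a < t"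
proof -
  have "accuracy (fibre_bot t) = t" "score a \<le> accuracy a"
    using assms by (auto simp: fibre_bot_def accuracy_def score_def IFV_def)
  then show ?thesis by (auto simp: less_XY_def)
qed

lemma order_base_IFV_cases [consumes 2, case_names both right left]:
  assumes "openin (order_topology_on IFV (<\<^sub>X\<^sub>Y)) U" "x \<in> U"
  obtains a b where "a \<in> IFV" "b \<in> IFV" "a <\<^sub>X\<^sub>Y x" "x <\<^sub>X\<^sub>Y b" "{y \<in> IFV. a <\<^sub>X\<^sub>Y y \<and> y <\<^sub>X\<^sub>Y b} \<subseteq> U"
    | b where "b \<in> IFV" "x <\<^sub>X\<^sub>Y b" "{y \<in> IFV. y <\<^sub>X\<^sub>Y b} \<subseteq> U"
    | a where "a \<in> IFV" "a <\<^sub>X\<^sub>Y x" "{y \<in> IFV. a <\<^sub>X\<^sub>Y y} \<subseteq> U"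
proof -
  obtain W where "W \<in> order_base IFV (<\<^sub>X\<^sub>Y)" "x \<in> W" "W \<subseteq> U"
    using assms unfolding openin_order_topology_IFV union_of_def by auto
  then show thesis
    using that unfolding order_base_def by blast
qed

text \<open>An upper end \<open>b\<close> of a basic interval around \<open>fibre_top l\<close> has
  score strictly above \<open>l\<close>, which leaves room for \<delta>; a lower end has score at
  most \<open>l\<close> and excludes no larger score.\<close>

lemma openin_fibre_top_right:
  assumes "openin (order_topology_on IFV (<\<^sub>X\<^sub>Y)) U" "fibre_top l \<in> U"
  shows "\<exists>\<delta>>0. \<forall>y\<in>IFV. l < score y \<and> score y < l + \<delta> \<longrightarrow> y \<in> U"
  using assms
proof (cases rule: order_base_IFV_cases)
  case (both a b)
  then have "l < score b" by (simp add: fibre_top_less_XY_iff)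
  have "score a \<le> l" using both(3) by (auto simp: less_XY_def)
  have "y \<in> U" if "y \<in> IFV" "l < score y" "score y < score b" for y
    using that both \<open>score a \<le> l\<close> by (auto simp: less_XY_def)
  with \<open>l < score b\<close> show ?thesis by (intro exI[of _ "score b - l"]) auto
next
  case (right b)
  then have "l < score b" by (simp add: fibre_top_less_XY_iff)
  moreover have "y \<in> U" if "y \<in> IFV" "score y < score b" for y
    using that right by (auto simp: less_XY_def)
  ultimately show ?thesis by (intro exI[of _ "score b - l"]) auto
next
  case (left a)
  then have "score a \<le> l" by (auto simp: less_XY_def)
  then have "y \<in> U" if "y \<in> IFV" "l < score y" for y
    using that left by (auto simp: less_XY_def)
  \<comment> \<open>The interval has no upper end, so any positive \<delta> would do.\<close>
  then show ?thesis by (intro exI[of _ 1]) auto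
qed

text \<open>Mirror image of \<open>openin_fibre_top_right\<close>, with the two ends of the interval
  exchanged.\<close>

lemma openin_fibre_bot_left:
  assumes "openin (order_topology_on IFV (<\<^sub>X\<^sub>Y)) U" "fibre_bot l \<in> U"
  shows "\<exists>\<delta>>0. \<forall>y\<in>IFV. l - \<delta> < score y \<and> score y < l \<longrightarrow> y \<in> U"
  using assms
proof (cases rule: order_base_IFV_cases)
  case (both a b)
  then have "score a < l" by (simp add: less_XY_fibre_bot_iff)
  have "l \<le> score b" using both(4) by (auto simp: less_XY_def)
  have "y \<in> U" if "y \<in> IFV" "score a < score y" "score y < l" for y
    using that both \<open>l \<le> score b\<close> by (auto simp: less_XY_def)
  with \<open>score a < l\<close> show ?thesis by (intro exI[of _ "l - score a"]) auto
next
  case (right b)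
  then have "l \<le> score b" by (auto simp: less_XY_def)
  then have "y \<in> U" if "y \<in> IFV" "score y < l" for y
    using that right by (auto simp: less_XY_def)
  then show ?thesis by (intro exI[of _ 1]) auto
next
  case (left a)
  then have "score a < l" by (simp add: less_XY_fibre_bot_iff)
  moreover have "y \<in> U" if "y \<in> IFV" "score a < score y" for y
    using that left by (auto simp: less_XY_def)
  ultimately show ?thesis by (intro exI[of _ "l - score a"]) auto
qed

theorem corollary5p2:
  shows "\<not> metrizable_space (order_topology_on IFV (<\<^sub>X\<^sub>Y))"
proof
  assume "metrizable_space (order_topology_on IFV (<\<^sub>X\<^sub>Y))"
  then obtain M d where "Metric_space M d"
    and top: "order_topology_on IFV (<\<^sub>X\<^sub>Y) = Metric_space.mtopology M d"
    unfolding metrizable_space_def by blast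
  interpret Metric_space M d by fact
  have M: "M = IFV"
    using topspace_order_topology_IFV top by simp
  define gap where "gap t = d (fibre_bot t) (fibre_top t)" for t
  have ends: "fibre_bot t \<in> M" "fibre_top t \<in> M" if "t \<in> {0..1}" for t
    using that M fibre_bot_in_IFV fibre_top_in_IFV by auto
  \<comment> \<open>The value \<open>t = l\<close> has to be excluded: for \<open>l < 1\<close> the
    number \<open>gap l\<close> is itself positive.\<close>
  have small: "\<exists>\<delta>>0. \<forall>t\<in>{0..1}. t \<noteq> l \<and> \<bar>t - l\<bar> < \<delta> \<longrightarrow> gap t < e"
    if l: "l \<in> {0..1}" and "0 < e" for l e
  proof -
    have open_ball: "openin (order_topology_on IFV (<\<^sub>X\<^sub>Y)) (mball x (e / 2))" for x
      by (simp add: top)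
    have "fibre_top l \<in> mball (fibre_top l) (e / 2)" "fibre_bot l \<in> mball (fibre_bot l) (e / 2)"
      using ends[OF l] \<open>0 < e\<close> by auto
    then obtain \<delta>1 \<delta>2 where \<delta>: "\<delta>1 > 0" "\<delta>2 > 0"
      and right: "\<And>y. y \<in> IFV \<Longrightarrow> l < score y \<Longrightarrow> score y < l + \<delta>1 \<Longrightarrow> y \<in> mball (fibre_top l) (e / 2)"
      and left: "\<And>y. y \<in> IFV \<Longrightarrow> l - \<delta>2 < score y \<Longrightarrow> score y < l \<Longrightarrow> y \<in> mball (fibre_bot l) (e / 2)"
      using openin_fibre_top_right[OF open_ball] openin_fibre_bot_left[OF open_ball] by metis
    have "gap t < e" if t: "t \<in> {0..1}" "t \<noteq> l" "\<bar>t - l\<bar> < min \<delta>1 \<delta>2" for t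
    proof -
      \<comment> \<open>Both ends of the fibre over \<open>t\<close> have score \<open>t\<close>, so
        they lie in the same ball: around the top over \<open>l\<close> if \<open>l < t\<close>,
        around the bottom if \<open>t < l\<close>.\<close>
      obtain c where c: "fibre_bot t \<in> mball c (e / 2)" "fibre_top t \<in> mball c (e / 2)"
      proof (cases "l < t")
        case True
        then show ?thesis
          using that[of "fibre_top l"] right[of "fibre_bot t"] right[of "fibre_top t"] ends[OF t(1)] t M
          by auto
      next
        case False
        then show ?thesis
          using that[of "fibre_bot l"] left[of "fibre_bot t"] left[of "fibre_top t"] ends[OF t(1)] t M
          by auto
      qed
      then show ?thesis
        using triangle'[of "fibre_bot t" c "fibre_top t"] by (auto simp: gap_def commute)
    qed
    then show ?thesis
      using \<delta> by (intro exI[of _ "min \<delta>1 \<delta>2"]) auto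
  qed
  have fin: "finite {t \<in> {0..1}. e \<le> gap t}" if "0 < e" for e
  proof (rule ccontr)
    assume "infinite {t \<in> {0..1}. e \<le> gap t}"
    \<comment> \<open>Near a limit point \<open>l\<close> there are \<open>t \<noteq> l\<close> with
      \<open>e \<le> gap t\<close>, contrary to \<open>small\<close>.\<close>
    then obtain l where "l \<in> {0..1}" "l islimpt {t \<in> {0..1}. e \<le> gap t}"
      using compact_eq_Bolzano_Weierstrass[of "{0..1::real}"] by auto
    then show False
      using small[of l e] \<open>0 < e\<close> unfolding islimpt_approachable dist_real_def by force
  qed
  \<comment> \<open>The fibre over 1 is a single point with gap 0, so the right end of the interval
    is left out.\<close>
  have "{0<..<1} \<subseteq> (\<Union>n. {t \<in> {0..1}. inverse (real (Suc n)) \<le> gap t})"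
  proof
    fix t :: real assume t: "t \<in> {0<..<1}"
    then have "0 < gap t"
      using ends[of t] fibre_bot_neq_fibre_top[of t] by (simp add: gap_def mdist_pos_eq)
    then obtain n where "inverse (real (Suc n)) < gap t"
      using reals_Archimedean by blast
    then show "t \<in> (\<Union>n. {t \<in> {0..1}. inverse (real (Suc n)) \<le> gap t})"
      using t by (auto intro: less_imp_le)
  qed
  moreover have "countable (\<Union>n. {t \<in> {0..1}. inverse (real (Suc n)) \<le> gap t})"
    by (intro countable_UN countableI_type countable_finite fin) simp
  ultimately have "countable {0<..<1::real}"
    using countable_subset by blast
  then show False
    using uncountable_open_interval[of 0 "1::real"] by simp
qed

end
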